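(* Fix a unit vector $\mathbf n\in\mathbb R^d$. Let $\Psi_U^{\mathbf n}:\mathcal D_1\times\mathcal D_2\to\mathbb R^{\ell}$ be a coupling function, and let $\Psi_Q^{\mathbf n}:\mathcal D_1\times\mathbb R^{m_1}\times\mathcal D_2\times\mathbb R^{m_2}\to\mathbb R^{\tilde\ell}$ be of the form $$\Psi_Q^{\mathbf n}\big((\mathbf U^-,\mathbf V^-),(\mathbf U^+,\mathbf V^+)\big)=\Big(\Psi_U^{\mathbf n}(\mathbf U^-,\mathbf U^+),\ \Psi_R^{\mathbf n}\big((\mathbf U^-,\mathbf V^-),(\mathbf U^+,\mathbf V^+)\big)\Big)$$ with $\Psi_R^{\mathbf n}$ taking values in $\mathbb R^{\tilde\ell-\ell}$ and chosen consistently, i.e. such that $\Psi_U^{\mathbf n}(\mathbf U^-,\mathbf U^+)=\mathbf 0$ is equivalent to $\Psi_Q^{\mathbf n}\big((\mathbf U^-,\mathbf F_1^{\mathbf n}(\mathbf U^-)),(\mathbf U^+,\mathbf F_2^{\mathbf n}(\mathbf U^+))\big)=\mathbf 0$ for all $\mathbf U^-\in\mathcal D_1$, $\mathbf U^+\in\mathcal D_2$. Suppose that for every $(\mathbf U^-,\mathbf V^-,\mathbf U^+,\mathbf V^+)\in\mathcal D_1\times\mathbb R^{m_1}\times\mathcal D_2\times\mathbb R^{m_2}$ the system $$\Psi_Q^{\mathbf n}\Big(\big(\mathbf U_R,\ \mathbf V^-+\mathbf\Lambda_1^{\mathbf n}(\mathbf U^--\mathbf U_R)\big),\ \big(\mathbf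 U_L,\ \mathbf V^++\mathbf\Lambda_2^{\mathbf n}(\mathbf U_L-\mathbf U^+)\big)\Big)=\mathbf 0$$ has a unique solution $(\mathbf U_R,\mathbf U_L)\in\mathcal D_1\times\mathcal D_2$. Then the map $$\mathcal{RS}:(\mathbf U^-,\mathbf V^-,\mathbf U^+,\mathbf V^+)\mapsto(\mathbf U_R,\mathbf V_R,\mathbf U_L,\mathbf V_L),\quad \mathbf V_R=\mathbf V^-+\mathbf\Lambda_1^{\mathbf n}(\mathbf U^--\mathbf U_R),\quad \mathbf V_L=\mathbf V^++\mathbf\Lambda_2^{\mathbf n}(\mathbf U_L-\mathbf U^+),$$ where $(\mathbf U_R,\mathbf U_L)$ is this unique solution, is a Riemann solver.
   Context: Let $\mathcal D_i\subseteq\mathbb R^{m_i}$ for $i\in\{1,2\}$, let $\mathbf F_i^{\mathbf n}:\mathcal D_i\to\mathbb R^{m_i}$ be the continuously differentiable normal fluxes, and let $\mathbf\Lambda_i^{\mathbf n}\in\mathbb R^{m_i\times m_i}$ be diagonal matrices with positive diagonal entries. The localized (quasi-one-dimensional) relaxation system is $$\partial_t\mathbf U+\partial_{x_{\mathbf n}}\mathbf V=\mathbf 0,\qquad \partial_t\mathbf V+(\mathbf\Lambda_i^{\mathbf n})^2\partial_{x_{\mathbf n}}\mathbf U=\tfrac1\varepsilon\big(\mathbf F_i^{\mathbf n}(\mathbf U)-\mathbf V\big),$$ with $i=1$ for $x_{\mathbf n}<0$ and $i=2$ for $x_{\mathbf n}>0$, with coupling condition $\Psi_Q^{\mathbf n}(\mathbf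 Q(t,0^-),\mathbf Q(t,0^+))=\mathbf 0$ for $\mathbf Q=(\mathbf U,\mathbf V)$, and Riemann data constant on each half-space, $(\mathbf U^-,\mathbf V^-)\in\mathcal D_1\times\mathbb R^{m_1}$ and $(\mathbf U^+,\mathbf V^+)\in\mathcal D_2\times\mathbb R^{m_2}$. A *Riemann solver* is a map $\mathcal{RS}:(\mathbf U^-,\mathbf V^-,\mathbf U^+,\mathbf V^+)\mapsto(\mathbf U_R,\mathbf V_R,\mathbf U_L,\mathbf V_L)$ from $\mathcal D_1\times\mathbb R^{m_1}\times\mathcal D_2\times\mathbb R^{m_2}$ to itself such that: 1. $\mathbf Q_R=(\mathbf U_R,\mathbf V_R)$ connects to $(\mathbf U^-,\mathbf V^-)$ by Lax curves of the left system with negative speed, and $\mathbf Q_L=(\mathbf U_L,\mathbf V_L)$ connects to $(\mathbf U^+,\mathbf V^+)$ by Lax curves of the right system with positive speed; explicitly, there exist $\mathbf\Sigma_1\in\mathbb R^{m_1}$, $\mathbf\Sigma_2\in\mathbb R^{m_2}$ with $\mathbf Q_R=(\mathbf U^--\mathbf\Sigma_1,\mathbf V^-+\mathbf\Lambda_1^{\mathbf n}\mathbf\Sigma_1)$ and $\mathbf Q_L=(\mathbf U^++\mathbf\Sigma_2,\mathbf V^++\mathbf\Lambda_2^{\mathbf n}\mathbf\Sigma_2)$; 2. $\Psi_Q^{\mathbf n}(\mathbf Q_R,\mathbf Q_L)=\mathbf 0$; 3. $\mathcal{RS}$ is idempotent: $\mathcal{RS}(\mathbf U_R,\mathbf V_R,\mathbf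 U_L,\mathbf V_L)=(\mathbf U_R,\mathbf V_R,\mathbf U_L,\mathbf V_L)$ for every $(\mathbf U_R,\mathbf V_R,\mathbf U_L,\mathbf V_L)$ in its image. *)

theory Defs
  imports "Jordan_Normal_Form.Matrix" "HOL-Analysis.Analysis"
begin

text \<open>
  States live in \<open>real ^ 'm\<close>. Values of coupling functions live in \<open>carrier_vec k\<close>, whose
  dimension is a natural number, so that coupling functions can be stacked with \<open>@\<^sub>v\<close> and
  a block may have length 0. Both libraries use \<open>$\<close> for components; here it means \<open>vec_nth\<close>.
\<close>

no_notation Matrix.vec_index (infixl \<open>$\<close> 100)

text \<open>
  The domain is an arbitrary set, so derivatives are taken within it. On an open set this is
  the usual notion; in general it only asks that some continuous choice of derivatives exists.
\<close>

definition continuously_differentiable_on ::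
  "('a::real_normed_vector \<Rightarrow> 'b::real_normed_vector) \<Rightarrow> 'a set \<Rightarrow> bool"
  (infix \<open>continuously'_differentiable'_on\<close> 50) where
  "f continuously_differentiable_on S \<longleftrightarrow>
     (\<exists>f' :: 'a \<Rightarrow> 'a \<Rightarrow>\<^sub>L 'b.
        (\<forall>x\<in>S. (f has_derivative blinfun_apply (f' x)) (at x within S)) \<and> continuous_on S f')"

definition positive_diagonal :: "real ^ 'm ^ 'm \<Rightarrow> bool" where
  "positive_diagonal \<Lambda> \<longleftrightarrow> (\<forall>i j. i \<noteq> j \<longrightarrow> \<Lambda> $ i $ j = 0) \<and> (\<forall>i. 0 < \<Lambda> $ i $ i)"

type_synonym 'm state = "(real ^ 'm) \<times> (real ^ 'm)"

type_synonym ('m1, 'm2) riemann_data =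
  "(real ^ 'm1) \<times> (real ^ 'm1) \<times> (real ^ 'm2) \<times> (real ^ 'm2)"

type_synonym ('m1, 'm2) coupling = "'m1 state \<Rightarrow> 'm2 state \<Rightarrow> real Matrix.vec"

definition data_domain ::
  "(real ^ 'm1) set \<Rightarrow> (real ^ 'm2) set \<Rightarrow> ('m1, 'm2) riemann_data set" where
  "data_domain D1 D2 = D1 \<times> UNIV \<times> D2 \<times> UNIV"

text \<open>
  The relaxation system is linear in its principal part, with characteristic speeds
  \<open>\<plusminus>\<Lambda> $ k $ k\<close> and eigenvectors \<open>(axis k 1, \<plusminus>\<Lambda> *v axis k 1)\<close>, so its Lax curves are
  straight lines. Composing the curves of all negative (positive) speeds gives the affine
  spaces below; \<open>\<Sigma>\<close> collects the curve parameters.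
\<close>

definition left_lax_connected :: "real ^ 'm ^ 'm \<Rightarrow> 'm state \<Rightarrow> 'm state \<Rightarrow> bool" where
  "left_lax_connected \<Lambda> Q\<^sub>m Q\<^sub>R \<longleftrightarrow>
     (\<exists>\<Sigma>. Q\<^sub>R = (fst Q\<^sub>m - \<Sigma>, snd Q\<^sub>m + \<Lambda> *v \<Sigma>))"

definition right_lax_connected :: "real ^ 'm ^ 'm \<Rightarrow> 'm state \<Rightarrow> 'm state \<Rightarrow> bool" where
  "right_lax_connected \<Lambda> Q\<^sub>p Q\<^sub>L \<longleftrightarrow>
     (\<exists>\<Sigma>. Q\<^sub>L = (fst Q\<^sub>p + \<Sigma>, snd Q\<^sub>p + \<Lambda> *v \<Sigma>))"

text \<open>Subscripts \<open>m\<close> and \<open>p\<close> stand for the superscripts minus and plus (the data at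
  \<open>x < 0\<close> and \<open>x > 0\<close>); \<open>k\<close> is the number of scalar coupling conditions.\<close>

definition riemann_solver ::
  "(real ^ 'm1) set \<Rightarrow> (real ^ 'm2) set \<Rightarrow> real ^ 'm1 ^ 'm1 \<Rightarrow> real ^ 'm2 ^ 'm2 \<Rightarrow>
   nat \<Rightarrow> ('m1, 'm2) coupling \<Rightarrow>
   (('m1, 'm2) riemann_data \<Rightarrow> ('m1, 'm2) riemann_data) \<Rightarrow> bool" where
  "riemann_solver D1 D2 \<Lambda>1 \<Lambda>2 k \<Psi>Q RS \<longleftrightarrow>
     RS \<in> data_domain D1 D2 \<rightarrow> data_domain D1 D2 \<and>
     (\<forall>U\<^sub>m V\<^sub>m U\<^sub>p V\<^sub>p U\<^sub>R V\<^sub>R U\<^sub>L V\<^sub>L.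
        (U\<^sub>m, V\<^sub>m, U\<^sub>p, V\<^sub>p) \<in> data_domain D1 D2 \<longrightarrow>
        RS (U\<^sub>m, V\<^sub>m, U\<^sub>p, V\<^sub>p) = (U\<^sub>R, V\<^sub>R, U\<^sub>L, V\<^sub>L) \<longrightarrow>
        left_lax_connected \<Lambda>1 (U\<^sub>m, V\<^sub>m) (U\<^sub>R, V\<^sub>R) \<and>
        right_lax_connected \<Lambda>2 (U\<^sub>p, V\<^sub>p) (U\<^sub>L, V\<^sub>L) \<and>
        \<Psi>Q (U\<^sub>R, V\<^sub>R) (U\<^sub>L, V\<^sub>L) = 0\<^sub>v k) \<and>
     (\<forall>q \<in> RS ` data_domain D1 D2. RS q = q)"

definition solves_coupling ::
  "(real ^ 'm1) set \<Rightarrow> (real ^ 'm2) set \<Rightarrow> real ^ 'm1 ^ 'm1 \<Rightarrow> real ^ 'm2 ^ 'm2 \<Rightarrow>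
   nat \<Rightarrow> ('m1, 'm2) coupling \<Rightarrow> ('m1, 'm2) riemann_data \<Rightarrow>
   (real ^ 'm1) \<times> (real ^ 'm2) \<Rightarrow> bool" where
  "solves_coupling D1 D2 \<Lambda>1 \<Lambda>2 k \<Psi>Q = (\<lambda>(U\<^sub>m, V\<^sub>m, U\<^sub>p, V\<^sub>p) (U\<^sub>R, U\<^sub>L).
     U\<^sub>R \<in> D1 \<and> U\<^sub>L \<in> D2 \<and>
     \<Psi>Q (U\<^sub>R, V\<^sub>m + \<Lambda>1 *v (U\<^sub>m - U\<^sub>R)) (U\<^sub>L, V\<^sub>p + \<Lambda>2 *v (U\<^sub>L - U\<^sub>p)) = 0\<^sub>v k)"

text \<open>Meaningful only on data for which the coupling system is uniquely solvable.\<close>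

definition coupling_RS ::
  "(real ^ 'm1) set \<Rightarrow> (real ^ 'm2) set \<Rightarrow> real ^ 'm1 ^ 'm1 \<Rightarrow> real ^ 'm2 ^ 'm2 \<Rightarrow>
   nat \<Rightarrow> ('m1, 'm2) coupling \<Rightarrow> ('m1, 'm2) riemann_data \<Rightarrow> ('m1, 'm2) riemann_data" where
  "coupling_RS D1 D2 \<Lambda>1 \<Lambda>2 k \<Psi>Q = (\<lambda>(U\<^sub>m, V\<^sub>m, U\<^sub>p, V\<^sub>p).
     let (U\<^sub>R, U\<^sub>L) = (THE s. solves_coupling D1 D2 \<Lambda>1 \<Lambda>2 k \<Psi>Q (U\<^sub>m, V\<^sub>m, U\<^sub>p, V\<^sub>p) s)
     in (U\<^sub>R, V\<^sub>m + \<Lambda>1 *v (U\<^sub>m - U\<^sub>R), U\<^sub>L, V\<^sub>p + \<Lambda>2 *v (U\<^sub>L - U\<^sub>p)))"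

end

theory Submission
  imports Defs
begin

text \<open>
  Restarting from a solution \<open>(U\<^sub>R, V\<^sub>R, U\<^sub>L, V\<^sub>L)\<close>, the pair \<open>(U\<^sub>R, U\<^sub>L)\<close> solves the new
  coupling system with vanishing wave strengths; by uniqueness the solver returns its
  argument, which is idempotence. Admissibility holds with \<open>\<Sigma>\<^sub>1 = U\<^sub>m - U\<^sub>R\<close> and
  \<open>\<Sigma>\<^sub>2 = U\<^sub>L - U\<^sub>p\<close>.
\<close>

text \<open>Unique solvability makes the definite description in \<open>coupling_RS\<close> agree
  with any solution that can be exhibited, so later arguments need only produce a solution and never
  unfold \<open>THE\<close>.\<close>

lemma coupling_RS_eqI:
  assumes "\<exists>!s. solves_coupling D1 D2 \<Lambda>1 \<Lambda>2 k \<Psi>Q (U\<^sub>m, V\<^sub>m, U\<^sub>p, V\<^sub>p) s"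
    and "solves_coupling D1 D2 \<Lambda>1 \<Lambda>2 k \<Psi>Q (U\<^sub>m, V\<^sub>m, U\<^sub>p, V\<^sub>p) (U\<^sub>R, U\<^sub>L)"
  shows "coupling_RS D1 D2 \<Lambda>1 \<Lambda>2 k \<Psi>Q (U\<^sub>m, V\<^sub>m, U\<^sub>p, V\<^sub>p) =
    (U\<^sub>R, V\<^sub>m + \<Lambda>1 *v (U\<^sub>m - U\<^sub>R), U\<^sub>L, V\<^sub>p + \<Lambda>2 *v (U\<^sub>L - U\<^sub>p))"
  using the1_equality[OF assms] by (simp add: coupling_RS_def)

text \<open>Converse use of the description: it recovers from the output alone everything the solver
  properties need. The last conclusion is the coupling condition evaluated at the output states
  themselves.\<close>

lemma coupling_RS_solves:
  assumes "\<exists>!s. solves_coupling D1 D2 \<Lambda>1 \<Lambda>2 k \<Psi>Q (U\<^sub>m, V\<^sub>m, U\<^sub>p, V\<^sub>p) s"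
    and "coupling_RS D1 D2 \<Lambda>1 \<Lambda>2 k \<Psi>Q (U\<^sub>m, V\<^sub>m, U\<^sub>p, V\<^sub>p) = (U\<^sub>R, V\<^sub>R, U\<^sub>L, V\<^sub>L)"
  shows "U\<^sub>R \<in> D1" "U\<^sub>L \<in> D2" "V\<^sub>R = V\<^sub>m + \<Lambda>1 *v (U\<^sub>m - U\<^sub>R)" "V\<^sub>L = V\<^sub>p + \<Lambda>2 *v (U\<^sub>L - U\<^sub>p)"
    "\<Psi>Q (U\<^sub>R, V\<^sub>R) (U\<^sub>L, V\<^sub>L) = 0\<^sub>v k"
proof -
  obtain W\<^sub>R W\<^sub>L where
    W: "solves_coupling D1 D2 \<Lambda>1 \<Lambda>2 k \<Psi>Q (U\<^sub>m, V\<^sub>m, U\<^sub>p, V\<^sub>p) (W\<^sub>R, W\<^sub>L)"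
    using assms(1) by (metis surj_pair)
  \<comment> \<open>Comparing the two forms of the output identifies \<open>W\<^sub>R\<close>,
    \<open>W\<^sub>L\<close> with \<open>U\<^sub>R\<close>, \<open>U\<^sub>L\<close>; the remaining
    components are exactly the second entries inside \<open>\<Psi>Q\<close> in
    \<open>solves_coupling\<close>.\<close>
  with coupling_RS_eqI[OF assms(1) W] assms(2)
  show "U\<^sub>R \<in> D1" "U\<^sub>L \<in> D2" "V\<^sub>R = V\<^sub>m + \<Lambda>1 *v (U\<^sub>m - U\<^sub>R)" "V\<^sub>L = V\<^sub>p + \<Lambda>2 *v (U\<^sub>L - U\<^sub>p)"
    "\<Psi>Q (U\<^sub>R, V\<^sub>R) (U\<^sub>L, V\<^sub>L) = 0\<^sub>v k"
    by (auto simp: solves_coupling_def)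
qed

lemma coupling_RS_fixed:
  assumes "\<exists>!s. solves_coupling D1 D2 \<Lambda>1 \<Lambda>2 k \<Psi>Q (U\<^sub>R, V\<^sub>R, U\<^sub>L, V\<^sub>L) s"
    and "U\<^sub>R \<in> D1" "U\<^sub>L \<in> D2" "\<Psi>Q (U\<^sub>R, V\<^sub>R) (U\<^sub>L, V\<^sub>L) = 0\<^sub>v k"
  shows "coupling_RS D1 D2 \<Lambda>1 \<Lambda>2 k \<Psi>Q (U\<^sub>R, V\<^sub>R, U\<^sub>L, V\<^sub>L) = (U\<^sub>R, V\<^sub>R, U\<^sub>L, V\<^sub>L)"
proof -
  have "solves_coupling D1 D2 \<Lambda>1 \<Lambda>2 k \<Psi>Q (U\<^sub>R, V\<^sub>R, U\<^sub>L, V\<^sub>L) (U\<^sub>R, U\<^sub>L)"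
    \<comment> \<open>Both differences of states are zero here, so the matrix terms drop out and the
      coupling equation becomes the last assumption.\<close>
    using assms(2-) by (simp add: solves_coupling_def)
  then show ?thesis
    using coupling_RS_eqI[OF assms(1)] by simp
qed

text \<open>Unique solvability enters at two places: at the given data, where it yields
  admissibility and the coupling condition, and at the output of the solver, where it yields
  idempotence.\<close>

lemma coupling_RS_riemann_solver:
  assumes unique: "\<And>q. q \<in> data_domain D1 D2 \<Longrightarrow>
      \<exists>!s. solves_coupling D1 D2 \<Lambda>1 \<Lambda>2 k \<Psi>Q q s"
  shows "riemann_solver D1 D2 \<Lambda>1 \<Lambda>2 k \<Psi>Q (coupling_RS D1 D2 \<Lambda>1 \<Lambda>2 k \<Psi>Q)"
    (is "riemann_solver _ _ _ _ _ _ ?RS")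
proof -
  have connected: "left_lax_connected \<Lambda>1 (U\<^sub>m, V\<^sub>m) (U\<^sub>R, V\<^sub>R) \<and>
      right_lax_connected \<Lambda>2 (U\<^sub>p, V\<^sub>p) (U\<^sub>L, V\<^sub>L) \<and> \<Psi>Q (U\<^sub>R, V\<^sub>R) (U\<^sub>L, V\<^sub>L) = 0\<^sub>v k"
    if "(U\<^sub>m, V\<^sub>m, U\<^sub>p, V\<^sub>p) \<in> data_domain D1 D2"
      and "?RS (U\<^sub>m, V\<^sub>m, U\<^sub>p, V\<^sub>p) = (U\<^sub>R, V\<^sub>R, U\<^sub>L, V\<^sub>L)"
    for U\<^sub>m V\<^sub>m U\<^sub>p V\<^sub>p U\<^sub>R V\<^sub>R U\<^sub>L V\<^sub>L
  proof -
    note sol = coupling_RS_solves[OF unique[OF that(1)] that(2)]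
    have "left_lax_connected \<Lambda>1 (U\<^sub>m, V\<^sub>m) (U\<^sub>R, V\<^sub>R)"
      unfolding left_lax_connected_def using sol(3) by (intro exI[of _ "U\<^sub>m - U\<^sub>R"]) simp
    moreover have "right_lax_connected \<Lambda>2 (U\<^sub>p, V\<^sub>p) (U\<^sub>L, V\<^sub>L)"
      unfolding right_lax_connected_def using sol(4) by (intro exI[of _ "U\<^sub>L - U\<^sub>p"]) simp
    ultimately show ?thesis using sol(5) by blast
  qed
  \<comment> \<open>Membership is proved together with the fixed-point equation because
    \<open>unique\<close> applies to the output only once the output is known to lie in
    \<open>data_domain D1 D2\<close>.\<close>
  have idempotent: "?RS q \<in> data_domain D1 D2 \<and> ?RS (?RS q) = ?RS q"
    if q: "q \<in> data_domain D1 D2" for q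
  proof -
    obtain U\<^sub>m V\<^sub>m U\<^sub>p V\<^sub>p where q_eq: "q = (U\<^sub>m, V\<^sub>m, U\<^sub>p, V\<^sub>p)" by (metis surj_pair)
    obtain U\<^sub>R V\<^sub>R U\<^sub>L V\<^sub>L where RS_q: "?RS q = (U\<^sub>R, V\<^sub>R, U\<^sub>L, V\<^sub>L)" by (metis surj_pair)
    note sol = coupling_RS_solves[OF unique[OF q, unfolded q_eq] RS_q[unfolded q_eq]]
    have "(U\<^sub>R, V\<^sub>R, U\<^sub>L, V\<^sub>L) \<in> data_domain D1 D2"
      using sol(1,2) by (simp add: data_domain_def)
    \<comment> \<open>Here \<open>unique\<close> is taken at the output; its premise is the
      membership just shown.\<close>
    with coupling_RS_fixed[OF unique sol(1,2,5)] show ?thesis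
      unfolding RS_q by blast
  qed
  show ?thesis
    unfolding riemann_solver_def using connected idempotent by (intro conjI) blast+
qed

theorem proposition3p2:
  fixes n :: "real ^ 'd"
    and D1 :: "(real ^ 'm1) set"
    and D2 :: "(real ^ 'm2) set"
    and F1 :: "real ^ 'd \<Rightarrow> real ^ 'm1 \<Rightarrow> real ^ 'm1"
    and F2 :: "real ^ 'd \<Rightarrow> real ^ 'm2 \<Rightarrow> real ^ 'm2"
    and \<Lambda>1 :: "real ^ 'd \<Rightarrow> real ^ 'm1 ^ 'm1"
    and \<Lambda>2 :: "real ^ 'd \<Rightarrow> real ^ 'm2 ^ 'm2"
    and l l' :: nat
    and \<Psi>U :: "real ^ 'd \<Rightarrow> real ^ 'm1 \<Rightarrow> real ^ 'm2 \<Rightarrow> real Matrix.vec"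
    and \<Psi>R \<Psi>Q :: "real ^ 'd \<Rightarrow> ('m1, 'm2) coupling"
  assumes unit: "norm n = 1"
    and F1: "F1 n continuously_differentiable_on D1"
    and F2: "F2 n continuously_differentiable_on D2"
    and \<Lambda>1: "positive_diagonal (\<Lambda>1 n)"
    and \<Lambda>2: "positive_diagonal (\<Lambda>2 n)"
    and dims: "l \<le> l'"
    and \<Psi>U: "\<And>U\<^sub>m U\<^sub>p. U\<^sub>m \<in> D1 \<Longrightarrow> U\<^sub>p \<in> D2 \<Longrightarrow> \<Psi>U n U\<^sub>m U\<^sub>p \<in> carrier_vec l"
    and \<Psi>R: "\<And>U\<^sub>m V\<^sub>m U\<^sub>p V\<^sub>p. U\<^sub>m \<in> D1 \<Longrightarrow> U\<^sub>p \<in> D2 \<Longrightarrow>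
               \<Psi>R n (U\<^sub>m, V\<^sub>m) (U\<^sub>p, V\<^sub>p) \<in> carrier_vec (l' - l)"
    and \<Psi>Q: "\<And>U\<^sub>m V\<^sub>m U\<^sub>p V\<^sub>p. U\<^sub>m \<in> D1 \<Longrightarrow> U\<^sub>p \<in> D2 \<Longrightarrow>
               \<Psi>Q n (U\<^sub>m, V\<^sub>m) (U\<^sub>p, V\<^sub>p) = \<Psi>U n U\<^sub>m U\<^sub>p @\<^sub>v \<Psi>R n (U\<^sub>m, V\<^sub>m) (U\<^sub>p, V\<^sub>p)"
    and consistent: "\<And>U\<^sub>m U\<^sub>p. U\<^sub>m \<in> D1 \<Longrightarrow> U\<^sub>p \<in> D2 \<Longrightarrow>
               \<Psi>U n U\<^sub>m U\<^sub>p = 0\<^sub>v l \<longleftrightarrow> \<Psi>Q n (U\<^sub>m, F1 n U\<^sub>m) (U\<^sub>p, F2 n U\<^sub>p) = 0\<^sub>v l'"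
    and unique: "\<And>q. q \<in> data_domain D1 D2 \<Longrightarrow>
               \<exists>!s. solves_coupling D1 D2 (\<Lambda>1 n) (\<Lambda>2 n) l' (\<Psi>Q n) q s"
  shows "riemann_solver D1 D2 (\<Lambda>1 n) (\<Lambda>2 n) l' (\<Psi>Q n)
           (coupling_RS D1 D2 (\<Lambda>1 n) (\<Lambda>2 n) l' (\<Psi>Q n))"
  using unique by (rule coupling_RS_riemann_solver)

end
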